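(* The language $\mathcal{L}(\mathcal{S}_{\mu})$ of the suffix conjugate $(\mathcal{S}_{\mu},H_{\mu})$ of the Thue-Morse subshift $(\mathcal{X}_{\mu},T)$ is regular. An infinite word $\mathbf{s}\in\{0,1,2,3\}^{\mathbb N}$ is in $\mathcal{S}_{\mu}$ if and only if it is the label of an infinite walk (starting at any vertex) on the directed labelled graph with vertices $q_3,q_4,q_5,q_6$ and edges $$q_3\xrightarrow{3}q_3,\quad q_3\xrightarrow{0}q_4,\quad q_4\xrightarrow{0}q_3,\quad q_3\xrightarrow{2}q_5,\quad q_5\xrightarrow{1}q_6,\quad q_6\xrightarrow{1}q_5,\quad q_6\xrightarrow{3}q_4,\quad q_6\xrightarrow{2}q_6 .$$ The mapping $H_{\mu}\colon\mathcal{S}_{\mu}\to\mathcal{S}_{\mu}$ is given by $$H_{\mu}(\mathbf{s})=\begin{cases}1\mathbf{z}&\text{if }\mathbf{s}=2\mathbf{z};\\ 0\mathbf{z}&\text{if }\mathbf{s}=3\mathbf{z};\\ \lambda(\mathbf{z})&\text{if }\mathbf{s}=a\mathbf{z}\text{ with }a\in\{0,1\}\text{ and }\mathbf{z}\in\{0,1\}^{\mathbb N};\\ \lambda(x2)\mathbf{z}&\text{if }\mathbf{s}=ax2\mathbf{z}\text{ with }a\in\{0,1\},\ x\in\{0,1\}^{*};\\ \lambda(x3)\mathbf{z}&\text{if }\mathbf{s}=ax3\mathbf{z}\text{ with }a\in\{0,1\},\ x\in\{0,1\}^{*},\end{cases}$$ where $\lambda$ is the morphism given by $\lambda(0)=2$,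 $\lambda(1)=3$, $\lambda(2)=21$, and $\lambda(3)=30$.
   Context: $\mu\colon\{0,1\}^*\to\{0,1\}^*$ is the Thue-Morse morphism $0\mapsto01$, $1\mapsto10$; $\mathbf{t}=\mu^{\omega}(0)=\lim_n\mu^n(0)$ is the Thue-Morse word; $T$ is the shift $(x_n)_{n\ge 0}\mapsto(x_{n+1})_{n\ge 0}$ on infinite words over any alphabet; $\mathcal{X}_{\mu}$ is the closure of $\{T^k\mathbf{t}:k\ge0\}$ in $\{0,1\}^{\mathbb N}$. Let $S=\{0,1,2,3\}$ and let $c$ be given by $c(0)=0$, $c(1)=1$, $c(2)=01$, $c(3)=10$ (a bijection from $S$ onto the set of nonempty suffixes of $\mu(0),\mu(1)$). For $\mathbf{s}=s_0s_1\cdots\in S^{\mathbb N}$ let $\pi(\mathbf{s})=c(s_0)\mu(c(s_1))\mu^{2}(c(s_2))\cdots$, and let $\mathcal{S}_{\mu}=\{\mathbf{s}\in S^{\mathbb N}:\pi(\mathbf{s})\in\mathcal{X}_{\mu}\}$. $\mathcal{L}(\mathcal{S}_\mu)$ is the set of all finite factors of elements of $\mathcal{S}_\mu$. The suffix conjugate of $(\mathcal{X}_\mu,T)$ is $(\mathcal{S}_{\mu},H_{\mu})$ with $H_{\mu}=T\circ G$, where $G\colon\mathcal{S}_{\mu}\to\mathcal{S}_{\mu}$ is defined as follows. Let $\mathbf{s}=s_0s_1\cdots\in\mathcal{S}_\mu$. If there is a smallest $r\ge0$ with $|c(s_r)|\ge2$, write $c(s_r)=au$ with $a$ a letter and $u$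 a nonempty word; then $G(\mathbf{s})=t_0t_1\cdots$ with $t_i=c^{-1}(\mu(c(s_i)))$ for $0\le i\le r-1$, $t_r=c^{-1}(\mu(a))$, $t_{r+1}=c^{-1}(u)$, and $t_i=s_{i-1}$ for $i\ge r+2$. If every $c(s_i)$ is a letter, then $G(\mathbf{s})=t_0t_1\cdots$ with $t_i=c^{-1}(\mu(c(s_i)))$ for all $i$. *)

theory Defs
  imports "HOL-Library.Stream" "HOL-Analysis.Function_Topology"
begin

text \<open>
  Letters are natural numbers, so that both alphabets \<open>{0, 1}\<close> and \<open>{0, 1, 2, 3}\<close> can be written
  literally and the former is a subset of the latter.  The maps on letters below are total on
  \<open>nat\<close>; the last branch of each conditional stands for the last letter of the intended alphabet,
  and values at other numbers are irrelevant.  Infinite words are streams, finite words are lists.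
\<close>

section \<open>The Thue--Morse subshift\<close>

definition morphism :: "('a \<Rightarrow> 'b list) \<Rightarrow> 'a list \<Rightarrow> 'b list" where
  "morphism h w = concat (map h w)"

definition morphism_inf :: "('a \<Rightarrow> 'b list) \<Rightarrow> 'a stream \<Rightarrow> 'b stream" where
  "morphism_inf h s = flat (smap h s)"

definition mu_letter :: "nat \<Rightarrow> nat list" where
  "mu_letter a = (if a = 0 then [0, 1] else [1, 0])"

definition mu :: "nat list \<Rightarrow> nat list" where
  "mu = morphism mu_letter"

text \<open>
  The limit of \<open>mu\<^sup>n(0)\<close>: these words are prefixes of one another and \<open>mu\<^sup>n(0)\<close> has length
  \<open>2^n > n\<close>, so the letter of the limit at position \<open>n\<close> is the one of \<open>mu\<^sup>n(0)\<close>
  (see \<open>thue_morse_prefix\<close> below).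
\<close>
definition thue_morse :: "nat stream" where
  "thue_morse = smap (\<lambda>n. (mu ^^ n) [0] ! n) nats"

text \<open>
  The type of streams carries no topology, so the closure is taken after identifying a stream
  with the function of its letters.
\<close>
definition X_mu :: "nat stream set" where
  "X_mu = {x. (\<lambda>n. x !! n) \<in>
     product_topology (\<lambda>_. discrete_topology {0, 1}) UNIV
       closure_of {(\<lambda>n. sdrop k thue_morse !! n) | k. True}}"

section \<open>The suffix conjugate\<close>

definition suff :: "nat \<Rightarrow> nat list" where
  "suff a = (if a = 0 then [0] else if a = 1 then [1] else if a = 2 then [0, 1] else [1, 0])"

definition suff_inv :: "nat list \<Rightarrow> nat" where
  "suff_inv = inv_into {0, 1, 2, 3} suff"

definition pi_mu :: "nat stream \<Rightarrow> nat stream" where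
  "pi_mu s = flat (smap (\<lambda>n. (mu ^^ n) (suff (s !! n))) nats)"

definition S_mu :: "nat stream set" where
  "S_mu = {s \<in> streams {0, 1, 2, 3}. pi_mu s \<in> X_mu}"

definition G_mu :: "nat stream \<Rightarrow> nat stream" where
  "G_mu s =
    (if \<exists>r. 2 \<le> length (suff (s !! r)) then
       let r = (LEAST r. 2 \<le> length (suff (s !! r)));
           a = hd (suff (s !! r));
           u = tl (suff (s !! r))
       in smap (\<lambda>i. if i < r then suff_inv (mu (suff (s !! i)))
                    else if i = r then suff_inv (mu [a])
                    else if i = r + 1 then suff_inv u
                    else s !! (i - 1)) nats
     else smap (\<lambda>i. suff_inv (mu (suff (s !! i)))) nats)"

text \<open>The shift on infinite words is \<^const>\<open>stl\<close>.\<close>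

definition H_mu :: "nat stream \<Rightarrow> nat stream" where
  "H_mu = stl \<circ> G_mu"

definition lambda_letter :: "nat \<Rightarrow> nat list" where
  "lambda_letter a =
    (if a = 0 then [2] else if a = 1 then [3] else if a = 2 then [2, 1] else [3, 0])"

section \<open>Factors, regular languages and the labelled graph\<close>

definition language :: "'a stream set \<Rightarrow> 'a list set" where
  "language A = {w. \<exists>s\<in>A. \<exists>u z. s = u @- w @- z}"

text \<open>
  Acceptance by a complete deterministic finite automaton over the alphabet \<open>\<Sigma>\<close>.  Taking the
  states to be natural numbers is no restriction, as the state set is finite.
\<close>
definition regular_language :: "'a set \<Rightarrow> 'a list set \<Rightarrow> bool" where
  "regular_language \<Sigma> L \<longleftrightarrow>
    (\<exists>(Q :: nat set) q\<^sub>0 F \<delta>. finite Q \<and> q\<^sub>0 \<in> Q \<and> F \<subseteq> Q \<and>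
       (\<forall>q\<in>Q. \<forall>a\<in>\<Sigma>. \<delta> q a \<in> Q) \<and>
       L = {w \<in> lists \<Sigma>. foldl \<delta> q\<^sub>0 w \<in> F})"

datatype vertex = q3 | q4 | q5 | q6

definition edges :: "(vertex \<times> nat \<times> vertex) set" where
  "edges = {(q3, 3, q3), (q3, 0, q4), (q4, 0, q3), (q3, 2, q5),
            (q5, 1, q6), (q6, 1, q5), (q6, 3, q4), (q6, 2, q6)}"

definition infinite_walk_label :: "('v \<times> 'a \<times> 'v) set \<Rightarrow> 'a stream \<Rightarrow> bool" where
  "infinite_walk_label E s \<longleftrightarrow> (\<exists>v :: 'v stream. \<forall>n. (v !! n, s !! n, v !! Suc n) \<in> E)"

section \<open>Consistency of the encodings\<close>

lemma mu_append: "mu (u @ v) = mu u @ mu v"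
  by (simp add: mu_def morphism_def)

lemma mu_funpow_append: "(mu ^^ n) (u @ v) = (mu ^^ n) u @ (mu ^^ n) v"
  by (induction n) (simp_all add: mu_append)

lemma length_mu: "length (mu w) = 2 * length w"
  by (induction w) (simp_all add: mu_def morphism_def mu_letter_def)

lemma length_mu_funpow: "length ((mu ^^ n) w) = 2 ^ n * length w"
  by (induction n) (simp_all add: length_mu)

lemma mu_funpow_prefix:
  assumes "m \<le> n"
  obtains v where "(mu ^^ n) [0] = (mu ^^ m) [0] @ v"
proof -
  have "\<exists>v. (mu ^^ n) [0] = (mu ^^ m) [0] @ v"
    using assms
  proof (induction n rule: dec_induct)
    case (step k)
    have "(mu ^^ Suc k) [0] = (mu ^^ k) ([0] @ [1])"
      by (simp add: funpow_swap1 mu_def morphism_def mu_letter_def)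
    then show ?case
      using step.IH by (metis append.assoc mu_funpow_append)
  qed simp
  then show ?thesis using that by blast
qed

lemma thue_morse_prefix: "stake (2 ^ n) thue_morse = (mu ^^ n) [0]"
proof (rule nth_equalityI)
  show "length (stake (2 ^ n) thue_morse) = length ((mu ^^ n) [0])"
    by (simp add: length_mu_funpow)
next
  fix i assume "i < length (stake (2 ^ n) thue_morse)"
  then have i: "i < 2 ^ n" by simp
  have "(mu ^^ i) [0] ! i = (mu ^^ n) [0] ! i"
  proof (cases "i \<le> n")
    case True
    then obtain v where "(mu ^^ n) [0] = (mu ^^ i) [0] @ v" by (rule mu_funpow_prefix)
    then show ?thesis by (simp add: nth_append length_mu_funpow)
  next
    case False
    then have "n \<le> i" by simp
    then obtain v where "(mu ^^ i) [0] = (mu ^^ n) [0] @ v" by (rule mu_funpow_prefix)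
    then show ?thesis using i by (simp add: nth_append length_mu_funpow)
  qed
  then show "stake (2 ^ n) thue_morse ! i = (mu ^^ n) [0] ! i"
    using i by (simp add: thue_morse_def)
qed

lemma bij_betw_suff:
  "bij_betw suff {0, 1, 2, 3} {u. u \<noteq> [] \<and> (\<exists>a\<in>{0, 1}. \<exists>v. mu [a] = v @ u)}"
proof -
  have "{u. u \<noteq> [] \<and> (\<exists>a\<in>{0, 1}. \<exists>v. mu [a] = v @ u)} = {[0], [1], [0, 1], [1, 0]}"
    by (auto simp: mu_def morphism_def mu_letter_def Cons_eq_append_conv)
  then show ?thesis
    by (auto simp: bij_betw_def inj_on_def suff_def)
qed

end

theory Submission
  imports Defs
begin

text \<open>
  Write \<open>X\<close> for the Thue--Morse subshift.  From \<open>\<pi>(a s) = c(a) \<mu>(\<pi>(s))\<close> one sees that membership in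
  \<open>\<S>\<close> can be tested letter by letter, provided one knows when \<open>c(a) \<mu>(y)\<close> belongs to \<open>X\<close>.

  Two facts about \<open>X\<close> decide this.  Every \<open>x \<in> X\<close> is \<open>\<mu>(z)\<close> or the shift of \<open>\<mu>(z)\<close> for some
  \<open>z \<in> X\<close> (\<open>X_mu_desubstitute\<close>), and the two cases exclude each other, since two offset decompositions
  into blocks \<open>01\<close>, \<open>10\<close> force a constant word, and \<open>X\<close> contains none
  (\<open>offset_decomposition_impossible\<close>).  Hence a short word in front of \<open>\<mu>(y)\<close> must be cut into blocks
  from the right, and what remains is a condition on the letters that may precede \<open>y\<close>.

  Each vertex of the graph stands for a two-letter left context: \<open>01\<close>, \<open>11\<close>, \<open>00\<close>, \<open>10\<close> for \<open>q3\<close>,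
  \<open>q4\<close>, \<open>q5\<close>, \<open>q6\<close>.  If \<open>p\<close> is the context of \<open>v\<close>, then \<open>p c(a) \<mu>(y) \<in> X\<close> exactly if there is an
  edge labelled \<open>a\<close> from \<open>v\<close> to a vertex whose context can precede \<open>y\<close> in \<open>X\<close>
  (\<open>left_context_step\<close>).  Following edges shows that every element of \<open>\<S>\<close> labels a walk, because
  each element of \<open>X\<close> can be extended to the left by two letters and so has a vertex to start from.
  Conversely, a walk shows that every prefix of \<open>\<pi>(s)\<close> begins some element of \<open>X\<close>, and \<open>X\<close> is closed
  (\<open>left_context_pi_mu_iff_walk\<close>).  Regularity is then the powerset construction
  (\<open>regular_language_of_walk_labels\<close>).

  The formulas for \<open>H\<close> come from reading off the letters of \<open>G\<close>: it adds two to each letter before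
  the first long one (\<open>2\<close> or \<open>3\<close>), and it splits that long letter into two.  They yield
  \<open>\<pi>(H(s)) = T(\<pi>(s))\<close> (\<open>pi_mu_H_mu\<close>), so \<open>H\<close> preserves \<open>\<S>\<close> because \<open>X\<close> is shift-invariant.
\<close>

section \<open>Infinite words and their images under morphisms\<close>

lemma stream_eqI: "(\<And>n. s !! n = t !! n) \<Longrightarrow> s = t"
  using smap_alt[of id s t] by (simp add: stream.map_id)

lemma stream_eq_by_prefixes:
  assumes "\<And>n. \<exists>u x' y'. n \<le> length u \<and> x = u @- x' \<and> y = u @- y'"
  shows "x = y"
proof (rule stream_eqI)
  fix n
  from assms[of "Suc n"] obtain u x' y' where "Suc n \<le> length u" "x = u @- x'" "y = u @- y'"
    by blast
  then show "x !! n = y !! n" by simp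
qed

lemma sdrop_unfold: "sdrop n s = s !! n ## sdrop (Suc n) s"
  by (metis sdrop_simps stream.collapse)

lemma smap_nats_Stream: "smap f nats = f 0 ## smap (\<lambda>n. f (Suc n)) nats"
proof (rule stream_eqI)
  fix n show "smap f nats !! n = (f 0 ## smap (\<lambda>n. f (Suc n)) nats) !! n"
    by (cases n) simp_all
qed

lemma morphism_simps [simp]:
  "morphism h [] = []"
  "morphism h (a # w) = h a @ morphism h w"
  "morphism h (u @ w) = morphism h u @ morphism h w"
  by (simp_all add: morphism_def)

lemma morphism_inf_Stream: "h a \<noteq> [] \<Longrightarrow> morphism_inf h (a ## s) = h a @- morphism_inf h s"
  by (simp add: morphism_inf_def)

lemma morphism_inf_shift:
  assumes "\<And>a. h a \<noteq> []"
  shows "morphism_inf h (w @- s) = morphism h w @- morphism_inf h s"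
  by (induction w) (simp_all add: morphism_inf_Stream assms)

lemma flat_stake:
  "(\<And>k. ws !! k \<noteq> []) \<Longrightarrow> flat ws = concat (stake n ws) @- flat (sdrop n ws)"
proof (induction n arbitrary: ws)
  case (Suc n)
  have "shd ws \<noteq> []" "stl ws !! k \<noteq> []" for k
    using Suc.prems[of 0] Suc.prems[of "Suc k"] by simp_all
  then show ?case using Suc.IH[of "stl ws"] by (simp add: flat_unfold[of ws])
qed simp

lemma length_concat_ge: "(\<And>w. w \<in> set ws \<Longrightarrow> w \<noteq> []) \<Longrightarrow> length ws \<le> length (concat ws)"
proof (induction ws)
  case (Cons w ws)
  then have "w \<noteq> []" "length ws \<le> length (concat ws)" by auto
  then show ?case by (cases w) auto
qed simp

lemma length_morphism_ge:
  assumes "\<And>a. h a \<noteq> []"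
  shows "length w \<le> length (morphism h w)"
proof -
  have "v \<noteq> []" if "v \<in> set (map h w)" for v using that assms by auto
  then have "length (map h w) \<le> length (concat (map h w))" by (rule length_concat_ge)
  then show ?thesis by (simp add: morphism_def)
qed

lemma morphism_concat: "morphism h (concat ws) = concat (map (morphism h) ws)"
  by (induction ws) simp_all

text \<open>
  Coinduction would have to be carried out up to concatenation.  Instead, both sides begin with the
  image of the first \<open>n\<close> blocks, whose length is at least \<open>n\<close>.
\<close>
lemma morphism_inf_flat:
  assumes h: "\<And>a. h a \<noteq> []" and ws: "\<And>k. ws !! k \<noteq> []"
  shows "morphism_inf h (flat ws) = flat (smap (morphism h) ws)"
proof (rule stream_eq_by_prefixes)
  fix n
  let ?u = "morphism h (concat (stake n ws))"
  have "morphism h w \<noteq> []" if "w \<noteq> []" for w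
    using length_morphism_ge[of h w] h that by auto
  then have "flat (smap (morphism h) ws) = ?u @- flat (sdrop n (smap (morphism h) ws))"
    using flat_stake[of "smap (morphism h) ws" n] ws by (simp add: morphism_concat)
  moreover have "morphism_inf h (flat ws) = ?u @- morphism_inf h (flat (sdrop n ws))"
    using flat_stake[of ws n] ws morphism_inf_shift[of h] h by metis
  moreover have "length (stake n ws) \<le> length (concat (stake n ws))"
  proof (rule length_concat_ge)
    fix w assume "w \<in> set (stake n ws)"
    then obtain i where "i < n" "w = stake n ws ! i" by (auto simp: in_set_conv_nth)
    then show "w \<noteq> []" using ws by simp
  qed
  then have "n \<le> length ?u"
    using length_morphism_ge[of h "concat (stake n ws)"] h by simp
  ultimately show "\<exists>u x' y'. n \<le> length u \<and> morphism_inf h (flat ws) = u @- x' \<and>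
      flat (smap (morphism h) ws) = u @- y'"
    by blast
qed

section \<open>The Thue--Morse morphism on infinite words\<close>

abbreviation mu_inf :: "nat stream \<Rightarrow> nat stream" where
  "mu_inf \<equiv> morphism_inf mu_letter"

lemma mu_letter_nonempty [simp]: "mu_letter a \<noteq> []"
  by (simp add: mu_letter_def)

lemma mu_inf_Stream: "a \<in> {0, 1} \<Longrightarrow> mu_inf (a ## y) = a ## (1 - a) ## mu_inf y"
  by (auto simp: morphism_inf_Stream mu_letter_def)

lemma mu_inf_shift: "mu_inf (w @- y) = mu w @- mu_inf y"
  by (simp add: morphism_inf_shift mu_def)

lemma binary_snth: "y \<in> streams {0, 1 :: nat} \<Longrightarrow> y !! n = 0 \<or> y !! n = 1"
  using snth_in[of y "{0, 1}" n] by auto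

lemma mu_inf_snth:
  assumes "y \<in> streams {0, 1}"
  shows "mu_inf y !! (2 * n) = y !! n" and "mu_inf y !! Suc (2 * n) = 1 - y !! n"
proof -
  have "mu_inf y !! (2 * n) = y !! n \<and> mu_inf y !! Suc (2 * n) = 1 - y !! n"
    using assms
  proof (induction n arbitrary: y)
    case 0
    then show ?case by (cases y) (auto simp: streams_Stream mu_inf_Stream)
  next
    case (Suc n)
    obtain a z where y: "y = a ## z" by (cases y)
    then have "mu_inf y = a ## (1 - a) ## mu_inf z" "z \<in> streams {0, 1}"
      using Suc.prems by (auto simp: streams_Stream mu_inf_Stream)
    then show ?case using Suc.IH[of z] y by simp
  qed
  then show "mu_inf y !! (2 * n) = y !! n" "mu_inf y !! Suc (2 * n) = 1 - y !! n" by auto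
qed

lemma mu_inf_eqI:
  assumes "y \<in> streams {0, 1}"
    and "\<And>n. x !! (2 * n) = y !! n" and "\<And>n. x !! Suc (2 * n) = 1 - y !! n"
  shows "x = mu_inf y"
proof (rule stream_eqI)
  fix n
  show "x !! n = mu_inf y !! n"
    using assms mu_inf_snth[OF assms(1), of "n div 2"] by (cases "even n") (auto elim!: evenE oddE)
qed

lemma mu_inf_inject:
  assumes "y \<in> streams {0, 1}" "z \<in> streams {0, 1}"
  shows "mu_inf y = mu_inf z \<longleftrightarrow> y = z"
  using mu_inf_snth(1)[OF assms(1)] mu_inf_snth(1)[OF assms(2)] by (metis stream_eqI)

text \<open>
  The two letters of a block differ.  Passing alternately between the blocks of two decompositions
  that are offset by one letter, every step therefore changes the letter, so that all blocks of
  either decomposition are equal.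
\<close>
lemma offset_decomposition_constant:
  assumes y: "y \<in> streams {0, 1}" and z: "z \<in> streams {0, 1}" and eq: "mu_inf y = stl (mu_inf z)"
  shows "y !! n = y !! 0" and "z !! n = z !! 0"
proof -
  have yz: "y !! n = 1 - z !! n" "1 - y !! n = z !! Suc n" for n
    using arg_cong[OF eq, of "\<lambda>x. x !! (2 * n)"] arg_cong[OF eq, of "\<lambda>x. x !! Suc (2 * n)"]
      mu_inf_snth[OF y, of n] mu_inf_snth[OF z, of n] mu_inf_snth[OF z, of "Suc n"]
    by simp_all
  have "y !! Suc n = y !! n" for n
    using yz[of n] yz[of "Suc n"] binary_snth[OF y, of n] binary_snth[OF y, of "Suc n"] by auto
  then have const: "y !! n = y !! 0" for n
    by (induction n) simp_all
  then show "y !! n = y !! 0" .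
  show "z !! n = z !! 0"
    using yz(1)[of n] yz(1)[of 0] const[of n] binary_snth[OF z, of n] binary_snth[OF z, of 0] by auto
qed

lemma thue_morse_binary: "thue_morse \<in> streams {0, 1}"
proof -
  have "set ((mu ^^ n) [0]) \<subseteq> {0, 1}" for n
    by (induction n) (auto simp: mu_def morphism_def mu_letter_def)
  then have "(mu ^^ n) [0] ! n \<in> {0, 1}" for n
    by (metis length_mu_funpow length_Cons list.size(3) less_exp mult.right_neutral nth_mem
        One_nat_def subset_eq)
  then show ?thesis by (simp add: streams_iff_snth thue_morse_def)
qed

lemma thue_morse_fixed_point: "mu_inf thue_morse = thue_morse"
proof (rule stream_eq_by_prefixes)
  fix n
  let ?u = "mu ((mu ^^ n) [0])"
  have "mu_inf thue_morse = ?u @- mu_inf (sdrop (2 ^ n) thue_morse)"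
    by (metis mu_inf_shift stake_sdrop thue_morse_prefix)
  moreover have "thue_morse = ?u @- sdrop (2 ^ Suc n) thue_morse"
    using thue_morse_prefix[of "Suc n"] stake_sdrop[of "2 ^ Suc n" thue_morse] by simp
  moreover have "n \<le> length ?u"
    unfolding length_mu length_mu_funpow using less_imp_le[OF less_exp[of n]]
    by (simp add: trans_le_add1 mult_2)
  ultimately show "\<exists>u x' y'. n \<le> length u \<and> mu_inf thue_morse = u @- x' \<and> thue_morse = u @- y'"
    by blast
qed

lemma thue_morse_snth:
  "thue_morse !! 0 = 0"
  "thue_morse !! (2 * n) = thue_morse !! n"
  "thue_morse !! Suc (2 * n) = 1 - thue_morse !! n"
  using mu_inf_snth[OF thue_morse_binary, of n]
  by (simp_all add: thue_morse_fixed_point) (simp add: thue_morse_def)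

text \<open>
  The Thue--Morse word recurs in itself: since \<open>3\<close> is a position of the letter \<open>0\<close>, the block
  \<open>mu\<^sup>n(0)\<close> at position \<open>0\<close> occurs again at \<open>3 * 2 ^ n\<close>.
\<close>
lemma thue_morse_prefix_recurs: "i < 2 ^ n \<Longrightarrow> thue_morse !! (3 * 2 ^ n + i) = thue_morse !! i"
proof (induction n arbitrary: i)
  case 0
  have "thue_morse !! 3 = 0"
    using thue_morse_snth(3)[of 1] thue_morse_snth(3)[of 0] thue_morse_snth(1)
    by (simp add: eval_nat_numeral del: snth.simps)
  then show ?case using 0 thue_morse_snth(1) by (simp del: snth.simps)
next
  case (Suc n)
  define j where "j = i div 2"
  have IH: "thue_morse !! (3 * 2 ^ n + j) = thue_morse !! j"
    using Suc unfolding j_def by simp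
  show ?case
  proof (cases "even i")
    case True
    then have "i = 2 * j" by (simp add: j_def)
    then show ?thesis
      using IH thue_morse_snth(2)[of "3 * 2 ^ n + j"] thue_morse_snth(2)[of j]
      by (simp add: algebra_simps)
  next
    case False
    then have "i = Suc (2 * j)" by (simp add: j_def)
    then show ?thesis
      using IH thue_morse_snth(3)[of "3 * 2 ^ n + j"] thue_morse_snth(3)[of j]
      by (simp add: algebra_simps)
  qed
qed

section \<open>The Thue--Morse subshift and its desubstitution\<close>

definition prefix_occurs :: "nat stream \<Rightarrow> nat \<Rightarrow> nat \<Rightarrow> bool" where
  "prefix_occurs x n k \<longleftrightarrow> (\<forall>i<n. x !! i = thue_morse !! (k + i))"

lemma prefix_occurs_mono: "prefix_occurs x n k \<Longrightarrow> m \<le> n \<Longrightarrow> prefix_occurs x m k"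
  by (simp add: prefix_occurs_def)

text \<open>
  The cylinders form a base of the product topology, so being in the orbit closure means that every
  prefix is found in the orbit.  The letters of \<open>x\<close> are then letters of the Thue--Morse word,
  so \<open>x\<close> is binary.
\<close>
lemma X_mu_iff: "x \<in> X_mu \<longleftrightarrow> (\<forall>n. \<exists>k. prefix_occurs x n k)"
proof
  let ?T = "product_topology (\<lambda>_ :: nat. discrete_topology {0, 1 :: nat}) UNIV"
  {
    assume "x \<in> X_mu"
    then have top: "(\<lambda>n. x !! n) \<in> topspace ?T"
      and cl: "\<And>U. (\<lambda>n. x !! n) \<in> U \<Longrightarrow> openin ?T U \<Longrightarrow>
        \<exists>k. (\<lambda>n. sdrop k thue_morse !! n) \<in> U"
      by (auto simp: X_mu_def in_closure_of simp del: topspace_product_topology)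
    show "\<forall>n. \<exists>k. prefix_occurs x n k"
    proof
      fix n
      define U where "U i = (if i < n then {x !! i} else {0, 1})" for i
      have "{i \<in> UNIV. U i \<noteq> topspace (discrete_topology {0, 1})} \<subseteq> {..<n}"
        by (auto simp: U_def)
      then have "finite {i \<in> UNIV. U i \<noteq> topspace (discrete_topology {0, 1})}"
        by (rule finite_subset) simp
      then have "openin ?T (PiE UNIV U)"
        unfolding openin_PiE_gen using top by (auto simp: U_def PiE_def Pi_def)
      moreover have "(\<lambda>n. x !! n) \<in> PiE UNIV U"
        using top by (auto simp: U_def PiE_def Pi_def)
      ultimately obtain k where "(\<lambda>n. sdrop k thue_morse !! n) \<in> PiE UNIV U"
        using cl by blast
      then have "\<forall>i. sdrop k thue_morse !! i \<in> U i" by (auto simp: PiE_def Pi_def)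
      then have "prefix_occurs x n k"
        unfolding prefix_occurs_def by (metis U_def sdrop_snth singletonD)
      then show "\<exists>k. prefix_occurs x n k" ..
    qed
  next
    assume *: "\<forall>n. \<exists>k. prefix_occurs x n k"
    have bin: "x !! i \<in> {0, 1}" for i
    proof -
      obtain k where "prefix_occurs x (Suc i) k" using * by blast
      then show ?thesis
        using binary_snth[OF thue_morse_binary, of "k + i"] by (auto simp: prefix_occurs_def)
    qed
    have "\<exists>y. y \<in> {\<lambda>n. sdrop k thue_morse !! n | k. True} \<and> y \<in> U"
      if U: "(\<lambda>n. x !! n) \<in> U" "openin ?T U" for U
    proof -
      from U obtain V where fin: "finite {i. V i \<noteq> {0, 1 :: nat}}"
        and V: "(\<lambda>n. x !! n) \<in> PiE UNIV V" "PiE UNIV V \<subseteq> U"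
        unfolding openin_product_topology_alt by fastforce
      obtain n where n: "\<And>i. V i \<noteq> {0, 1} \<Longrightarrow> i < n"
        using fin by (auto simp: finite_nat_set_iff_bounded)
      obtain k where k: "prefix_occurs x n k" using * by blast
      have "sdrop k thue_morse !! i \<in> V i" for i
      proof (cases "i < n")
        case True
        then have "sdrop k thue_morse !! i = x !! i" using k by (simp add: prefix_occurs_def sdrop_snth)
        then show ?thesis using V(1) by (auto simp: PiE_def Pi_def)
      next
        case False
        then show ?thesis using n[of i] binary_snth[OF thue_morse_binary] by (auto simp: sdrop_snth)
      qed
      then show ?thesis using V(2) by (intro exI[of _ "\<lambda>n. sdrop k thue_morse !! n"]) auto
    qed
    then show "x \<in> X_mu"
      using bin by (auto simp: X_mu_def in_closure_of PiE_def Pi_def)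
  }
qed

lemma X_mu_binary: "x \<in> X_mu \<Longrightarrow> x \<in> streams {0, 1}"
  unfolding streams_iff_snth X_mu_iff prefix_occurs_def
  using binary_snth[OF thue_morse_binary] by (metis insertCI lessI)

lemma X_mu_closed:
  assumes "\<And>n. \<exists>u x' y'. n \<le> length u \<and> x = u @- x' \<and> u @- y' \<in> X_mu"
  shows "x \<in> X_mu"
  unfolding X_mu_iff
proof
  fix n
  from assms[of n] obtain u x' y' where u: "n \<le> length u" "x = u @- x'" "u @- y' \<in> X_mu"
    by blast
  from u(3) obtain k where "prefix_occurs (u @- y') n k" by (auto simp: X_mu_iff)
  then have "prefix_occurs x n k" using u(1,2) by (simp add: prefix_occurs_def)
  then show "\<exists>k. prefix_occurs x n k" ..
qed

lemma sdrop_thue_morse_in_X_mu: "sdrop k thue_morse \<in> X_mu"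
  by (auto simp: X_mu_iff prefix_occurs_def sdrop_snth)

lemma X_mu_stl: "x \<in> X_mu \<Longrightarrow> stl x \<in> X_mu"
  unfolding X_mu_iff
proof
  fix n assume "\<forall>n. \<exists>k. prefix_occurs x n k"
  then obtain k where "prefix_occurs x (Suc n) k" by blast
  then have "prefix_occurs (stl x) n (Suc k)"
    by (auto simp: prefix_occurs_def simp flip: snth.simps(2))
  then show "\<exists>k. prefix_occurs (stl x) n k" ..
qed

lemma X_mu_tail: "a ## x \<in> X_mu \<Longrightarrow> x \<in> X_mu"
  using X_mu_stl[of "a ## x"] by simp

text \<open>
  This replaces passing to a convergent subsequence.  An occurrence of a prefix is one of every
  shorter prefix, so if both classes failed for some length, they would fail for the larger one.
\<close>
lemma prefix_occurs_pigeonhole: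
  assumes "\<forall>n. \<exists>k. prefix_occurs x n k \<and> (P k \<or> Q k)"
  shows "(\<forall>n. \<exists>k. prefix_occurs x n k \<and> P k) \<or> (\<forall>n. \<exists>k. prefix_occurs x n k \<and> Q k)"
proof (rule ccontr)
  assume "\<not> ?thesis"
  then obtain m n where "\<And>k. prefix_occurs x m k \<Longrightarrow> \<not> P k" "\<And>k. prefix_occurs x n k \<Longrightarrow> \<not> Q k"
    by blast
  moreover obtain k where "prefix_occurs x (max m n) k" "P k \<or> Q k" using assms by blast
  ultimately show False
    using prefix_occurs_mono[of x "max m n" k] max.cobounded1 max.cobounded2 by metis
qed

text \<open>
  Long prefixes of \<open>x\<close> occur with a letter in front of them, and one of the two letters works for
  arbitrarily long prefixes.
\<close>
lemma X_mu_extend_left: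
  assumes "x \<in> X_mu"
  shows "\<exists>a\<in>{0, 1}. a ## x \<in> X_mu"
proof -
  have "\<exists>k. prefix_occurs x n k \<and>
      (k > 0 \<and> thue_morse !! (k - 1) = 0 \<or> k > 0 \<and> thue_morse !! (k - 1) = 1)" for n
  proof -
    obtain k where k: "prefix_occurs x n k" using assms by (auto simp: X_mu_iff)
    \<comment> \<open>no letter precedes an occurrence at position \<open>0\<close>, which has to be replaced by a later one\<close>
    have "prefix_occurs x n (3 * 2 ^ n)" if "k = 0"
      using k that thue_morse_prefix_recurs less_exp[of n]
      by (metis add_0 less_trans prefix_occurs_def)
    with k have "\<exists>k>0. prefix_occurs x n k"
      by (metis bot_nat_0.not_eq_extremum mult_is_0 power_not_zero zero_neq_numeral)
    then show ?thesis using binary_snth[OF thue_morse_binary] by blast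
  qed
  then have "\<forall>n. \<exists>k. prefix_occurs x n k \<and>
      (k > 0 \<and> thue_morse !! (k - 1) = 0 \<or> k > 0 \<and> thue_morse !! (k - 1) = 1)" ..
  from prefix_occurs_pigeonhole[OF this] obtain a where a: "a \<in> {0, 1}"
    and occ: "\<And>n. \<exists>k. prefix_occurs x n k \<and> k > 0 \<and> thue_morse !! (k - 1) = a"
    by blast
  have "\<exists>k. prefix_occurs (a ## x) n k" for n
  proof -
    obtain k where k: "prefix_occurs x n k" "k > 0" "thue_morse !! (k - 1) = a"
      using occ by blast
    have "(a ## x) !! i = thue_morse !! (k - 1 + i)" if "i < n" for i
      using k that by (cases i) (auto simp: prefix_occurs_def)
    then show ?thesis by (auto simp: prefix_occurs_def)
  qed
  then show ?thesis using a by (auto simp: X_mu_iff)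
qed

lemma mu_inf_in_X_mu:
  assumes "y \<in> X_mu"
  shows "mu_inf y \<in> X_mu"
  unfolding X_mu_iff
proof
  fix n
  obtain k where k: "prefix_occurs y n k" using assms by (auto simp: X_mu_iff)
  have "mu_inf y !! i = thue_morse !! (2 * k + i)" if "i < n" for i
  proof -
    have "y !! (i div 2) = thue_morse !! (k + i div 2)"
      using k that by (simp add: prefix_occurs_def)
    then show ?thesis
      using mu_inf_snth[OF X_mu_binary[OF assms], of "i div 2"]
        thue_morse_snth(2,3)[of "k + i div 2"]
      by (cases "even i") (auto elim!: evenE oddE)
  qed
  then show "\<exists>k. prefix_occurs (mu_inf y) n k" by (auto simp: prefix_occurs_def)
qed

text \<open>
  By the pigeonhole principle, arbitrarily long prefixes of \<open>x\<close> occur in the fixed point at positions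
  of one parity, which tells where the blocks of \<open>x\<close> begin; the first letters of the blocks form the
  preimage.
\<close>
lemma X_mu_desubstitute:
  assumes "x \<in> X_mu"
  shows "\<exists>z\<in>X_mu. x = mu_inf z \<or> x = stl (mu_inf z)"
proof -
  have "\<forall>n. \<exists>k. prefix_occurs x n k \<and> (even k \<or> odd k)"
    using assms by (simp add: X_mu_iff)
  from prefix_occurs_pigeonhole[OF this] show ?thesis
  proof
    assume even: "\<forall>n. \<exists>k. prefix_occurs x n k \<and> even k"
    define z where "z = smap (\<lambda>i. x !! (2 * i)) nats"
    have occ: "\<exists>k. \<forall>i<n. x !! i = thue_morse !! (2 * k + i)" for n
      using even by (auto simp: prefix_occurs_def elim!: evenE)
    have zX: "z \<in> X_mu"
      unfolding X_mu_iff
    proof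
      fix n
      obtain k where "\<forall>i<2 * n. x !! i = thue_morse !! (2 * k + i)" using occ by blast
      then have "z !! i = thue_morse !! (k + i)" if "i < n" for i
        using that thue_morse_snth(2)[of "k + i"] by (simp add: z_def)
      then have "prefix_occurs z n k" by (simp add: prefix_occurs_def)
      then show "\<exists>k. prefix_occurs z n k" ..
    qed
    have "x = mu_inf z"
    proof (rule mu_inf_eqI[OF X_mu_binary[OF zX]])
      fix n
      show "x !! (2 * n) = z !! n" by (simp add: z_def)
      obtain k where "\<forall>i<2 * n + 2. x !! i = thue_morse !! (2 * k + i)" using occ by blast
      then have "x !! (2 * n) = thue_morse !! (2 * (k + n))"
        "x !! Suc (2 * n) = thue_morse !! Suc (2 * (k + n))"
        by (simp_all add: distrib_left del: snth.simps)
      then show "x !! Suc (2 * n) = 1 - z !! n"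
        unfolding thue_morse_snth by (simp add: z_def)
    qed
    then show ?thesis using zX by blast
  next
    assume odd: "\<forall>n. \<exists>k. prefix_occurs x n k \<and> odd k"
    \<comment> \<open>the first letter of \<open>x\<close> is the second half of the block coming from \<open>1 - x !! 0\<close>\<close>
    define z where "z = (1 - x !! 0) ## smap (\<lambda>i. x !! Suc (2 * i)) nats"
    have occ: "\<exists>k. \<forall>i<n. x !! i = thue_morse !! (Suc (2 * k) + i)" for n
    proof -
      obtain m where "prefix_occurs x n m" "odd m" using odd by blast
      moreover from this(2) obtain k where "m = Suc (2 * k)" by (auto elim: oddE)
      ultimately show ?thesis unfolding prefix_occurs_def by blast
    qed
    have z_occ: "z !! i = thue_morse !! (k + i)"
      if k: "\<forall>i<2 * n + 1. x !! i = thue_morse !! (Suc (2 * k) + i)" and "i \<le> n" for i n k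
    proof (cases i)
      case 0
      have "x !! 0 = 1 - thue_morse !! k" using k thue_morse_snth(3)[of k] by (simp del: snth.simps)
      then show ?thesis using 0 binary_snth[OF thue_morse_binary, of k] by (auto simp: z_def)
    next
      case (Suc j)
      then have "x !! Suc (2 * j) = thue_morse !! (2 * (k + i))"
        using k \<open>i \<le> n\<close> by (simp del: snth.simps)
      then show ?thesis using Suc thue_morse_snth(2)[of "k + i"] by (simp add: z_def)
    qed
    have zX: "z \<in> X_mu"
      unfolding X_mu_iff
    proof
      fix n
      obtain k where "\<forall>i<2 * n + 1. x !! i = thue_morse !! (Suc (2 * k) + i)" using occ by blast
      then have "prefix_occurs z n k"
        using z_occ[of n k] by (simp add: prefix_occurs_def)
      then show "\<exists>k. prefix_occurs z n k" ..
    qed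
    note z = mu_inf_snth[OF X_mu_binary[OF zX]]
    have "(1 - x !! 0) ## x = mu_inf z"
    proof (rule mu_inf_eqI[OF X_mu_binary[OF zX]])
      fix n
      show "((1 - x !! 0) ## x) !! (2 * n) = z !! n" by (cases n) (simp_all add: z_def)
      obtain k where k: "\<forall>i<2 * n + 1. x !! i = thue_morse !! (Suc (2 * k) + i)"
        using occ by blast
      then have "x !! (2 * n) = thue_morse !! Suc (2 * (k + n))"
        by (simp add: distrib_left del: snth.simps)
      then show "((1 - x !! 0) ## x) !! Suc (2 * n) = 1 - z !! n"
        using z_occ[OF k, of n] thue_morse_snth(3)[of "k + n"] by (simp add: snth_Stream del: snth.simps(2))
    qed
    then have "x = stl (mu_inf z)" by (metis stream.sel(2))
    then show ?thesis using zX by blast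
  qed
qed

text \<open>A desubstitution exhibits a complete block among the first three letters.\<close>
lemma X_mu_not_constant:
  assumes "x \<in> X_mu" and const: "\<And>n. x !! n = x !! 0"
  shows False
proof -
  obtain z where z: "z \<in> X_mu" "x = mu_inf z \<or> x = stl (mu_inf z)"
    using X_mu_desubstitute[OF assms(1)] by blast
  note bin = X_mu_binary[OF z(1)]
  from z(2) show False
  proof
    assume "x = mu_inf z"
    then show False
      using const[of 1] mu_inf_snth[OF bin, of 0] binary_snth[OF bin, of 0] by auto
  next
    assume "x = stl (mu_inf z)"
    then show False
      using const[of 1] const[of 2] mu_inf_snth[OF bin, of 1] binary_snth[OF bin, of 1]
      by (auto simp: eval_nat_numeral)
  qed
qed

text \<open>
  Recognizability: an element of the subshift determines where its blocks begin, since otherwise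
  its preimages would be constant.
\<close>
lemma offset_decomposition_impossible:
  assumes "y \<in> X_mu \<or> z \<in> X_mu" "y \<in> streams {0, 1}" "z \<in> streams {0, 1}"
  shows "mu_inf y \<noteq> stl (mu_inf z)"
proof
  assume eq: "mu_inf y = stl (mu_inf z)"
  note const = offset_decomposition_constant[OF assms(2,3) eq]
  from assms(1) show False
  proof
    assume "y \<in> X_mu"
    then show False using X_mu_not_constant const(1) by blast
  next
    assume "z \<in> X_mu"
    then show False using X_mu_not_constant const(2) by blast
  qed
qed

section \<open>Peeling off the short prefix in front of a substituted word\<close>

text \<open>
  The next four lemmas cut off up to four letters in front of \<open>\<mu>(y)\<close>.  By recognizability the blocks
  must be aligned with those of \<open>\<mu>(y)\<close>, and a single letter left over on the left is the second
  half of a block, which starts with the opposite letter.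
\<close>

lemma letter_mu_inf_in_X_mu_iff:
  assumes a: "a \<in> {0, 1}" and y: "y \<in> streams {0, 1}"
  shows "a ## mu_inf y \<in> X_mu \<longleftrightarrow> (1 - a) ## y \<in> X_mu"
proof -
  have bin: "(1 - a) ## y \<in> streams {0, 1}" using a y by (auto simp: streams_Stream)
  have eq: "a ## mu_inf y = stl (mu_inf ((1 - a) ## y))"
    using a by (auto simp: mu_inf_Stream)
  show ?thesis
  proof
    assume "(1 - a) ## y \<in> X_mu"
    then show "a ## mu_inf y \<in> X_mu"
      unfolding eq by (intro X_mu_stl mu_inf_in_X_mu)
  next
    assume "a ## mu_inf y \<in> X_mu"
    then obtain z where z: "z \<in> X_mu" "a ## mu_inf y = mu_inf z \<or> a ## mu_inf y = stl (mu_inf z)"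
      using X_mu_desubstitute by blast
    note zbin = X_mu_binary[OF z(1)]
    have "mu_inf z \<noteq> stl (mu_inf ((1 - a) ## y))"
      using offset_decomposition_impossible[of z] z(1) zbin bin by blast
    then have eq': "a ## mu_inf y = stl (mu_inf z)" using z(2) eq by metis
    obtain b w where zb: "z = b ## w" by (cases z)
    then have b: "b \<in> {0, 1}" "w \<in> streams {0, 1}" using zbin by (auto simp: streams_Stream)
    then have "a = 1 - b" "mu_inf y = mu_inf w" using eq' by (simp_all add: zb mu_inf_Stream)
    then have "z = (1 - a) ## y" using b y mu_inf_inject zb by auto
    then show "(1 - a) ## y \<in> X_mu" using z(1) by simp
  qed
qed

lemma block_mu_inf_in_X_mu_iff:
  assumes a: "a \<in> {0, 1}" and b: "b \<in> {0, 1}" and y: "y \<in> streams {0, 1}"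
  shows "a ## b ## mu_inf y \<in> X_mu \<longleftrightarrow> b = 1 - a \<and> a ## y \<in> X_mu"
proof
  assume "b = 1 - a \<and> a ## y \<in> X_mu"
  then show "a ## b ## mu_inf y \<in> X_mu"
    using mu_inf_in_X_mu[of "a ## y"] a by (auto simp: mu_inf_Stream)
next
  assume X: "a ## b ## mu_inf y \<in> X_mu"
  have y': "(1 - b) ## y \<in> X_mu"
    using X_mu_tail[OF X] letter_mu_inf_in_X_mu_iff[OF b y] by simp
  obtain z where z: "z \<in> X_mu"
    "a ## b ## mu_inf y = mu_inf z \<or> a ## b ## mu_inf y = stl (mu_inf z)"
    using X_mu_desubstitute[OF X] by blast
  obtain c w where zc: "z = c ## w" by (cases z)
  then have c: "c \<in> {0, 1}" "w \<in> streams {0, 1}"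
    using X_mu_binary[OF z(1)] by (auto simp: streams_Stream)
  have "mu_inf w \<noteq> stl (mu_inf ((1 - b) ## y))"
    using offset_decomposition_impossible[of w "(1 - b) ## y"] y' c X_mu_binary[OF y'] by blast
  then have "b ## mu_inf y \<noteq> mu_inf w" using b by (auto simp: mu_inf_Stream)
  then have "a ## b ## mu_inf y = mu_inf z" using z(2) c by (auto simp: zc mu_inf_Stream)
  then have "a = c" "b = 1 - c" "mu_inf y = mu_inf w" using c by (simp_all add: zc mu_inf_Stream)
  then show "b = 1 - a \<and> a ## y \<in> X_mu"
    using z(1) zc c y mu_inf_inject by auto
qed

lemma letter_block_mu_inf_in_X_mu_iff:
  assumes a: "a \<in> {0, 1}" and b: "b \<in> {0, 1}" and c: "c \<in> {0, 1}" and y: "y \<in> streams {0, 1}"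
  shows "a ## b ## c ## mu_inf y \<in> X_mu \<longleftrightarrow> c = 1 - b \<and> (1 - a) ## b ## y \<in> X_mu"
proof (cases "c = 1 - b")
  case True
  then have "b ## c ## mu_inf y = mu_inf (b ## y)" using b by (simp add: mu_inf_Stream)
  then show ?thesis
    using True letter_mu_inf_in_X_mu_iff[OF a, of "b ## y"] b y by (simp add: streams_Stream)
next
  case False
  then show ?thesis using block_mu_inf_in_X_mu_iff[OF b c y] X_mu_tail[of a] by blast
qed

lemma two_blocks_mu_inf_in_X_mu_iff:
  assumes a: "a \<in> {0, 1}" and b: "b \<in> {0, 1}" and c: "c \<in> {0, 1}" and d: "d \<in> {0, 1}"
    and y: "y \<in> streams {0, 1}"
  shows "a ## b ## c ## d ## mu_inf y \<in> X_mu \<longleftrightarrow> b = 1 - a \<and> d = 1 - c \<and> a ## c ## y \<in> X_mu"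
proof (cases "d = 1 - c")
  case True
  then have "c ## d ## mu_inf y = mu_inf (c ## y)" using c by (simp add: mu_inf_Stream)
  then show ?thesis
    using True block_mu_inf_in_X_mu_iff[OF a b, of "c ## y"] c y by (simp add: streams_Stream)
next
  case False
  then show ?thesis
    using block_mu_inf_in_X_mu_iff[OF c d y] X_mu_tail[of a] X_mu_tail[of b] by blast
qed

section \<open>Walks on the graph\<close>

definition walk :: "('v \<times> 'a \<times> 'v) set \<Rightarrow> 'v stream \<Rightarrow> 'a stream \<Rightarrow> bool" where
  "walk E vs s \<longleftrightarrow> (\<forall>n. (vs !! n, s !! n, vs !! Suc n) \<in> E)"

lemma infinite_walk_label_iff: "infinite_walk_label E s \<longleftrightarrow> (\<exists>vs. walk E vs s)"
  by (simp add: infinite_walk_label_def walk_def)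

lemma walk_Stream: "walk E vs (a ## s) \<longleftrightarrow> (shd vs, a, shd (stl vs)) \<in> E \<and> walk E (stl vs) s"
  unfolding walk_def
proof safe
  assume *: "\<forall>n. (vs !! n, (a ## s) !! n, vs !! Suc n) \<in> E"
  show "(shd vs, a, shd (stl vs)) \<in> E" using *[rule_format, of 0] by simp
  fix n show "(stl vs !! n, s !! n, stl vs !! Suc n) \<in> E" using *[rule_format, of "Suc n"] by simp
next
  fix n
  assume "(shd vs, a, shd (stl vs)) \<in> E" "\<forall>n. (stl vs !! n, s !! n, stl vs !! Suc n) \<in> E"
  then show "(vs !! n, (a ## s) !! n, vs !! Suc n) \<in> E" by (cases n) auto
qed

lemma walk_suffix: "walk E vs (u @- s) \<Longrightarrow> walk E (sdrop (length u) vs) s"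
  by (induction u arbitrary: vs) (auto simp: walk_Stream)

lemma walk_from_exists:
  assumes "\<And>v. \<exists>a w. (v, a, w) \<in> E"
  shows "\<exists>s vs. shd vs = v \<and> walk E vs s"
proof -
  have "\<exists>f. \<forall>n. (n = 0 \<longrightarrow> f n = v) \<and> (\<exists>a. (f n, a, f (Suc n)) \<in> E)"
    by (rule dependent_nat_choice) (use assms in blast)+
  then obtain f where "f 0 = v" and "\<forall>n. \<exists>a. (f n, a, f (Suc n)) \<in> E" by blast
  then obtain g where "\<forall>n. (f n, g n, f (Suc n)) \<in> E" by metis
  then have "walk E (smap f nats) (smap g nats)" by (simp add: walk_def)
  moreover have "shd (smap f nats) = v" using \<open>f 0 = v\<close> by simp
  ultimately show ?thesis by blast
qed

text \<open>
  Powerset construction.  A walk can be started at any vertex and every finite walk can be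
  prolonged, so the factors of the labels of infinite walks are the words on which the set of
  reachable vertices, starting from all vertices, does not become empty.
\<close>
lemma regular_language_of_walk_labels:
  fixes E :: "('v \<times> 'a \<times> 'v) set"
  assumes fin: "finite (UNIV :: 'v set)"
    and out: "\<And>v. \<exists>a w. (v, a, w) \<in> E"
    and labels: "\<And>v a w. (v, a, w) \<in> E \<Longrightarrow> a \<in> \<Sigma>"
  shows "regular_language \<Sigma> (language {s. infinite_walk_label E s})"
proof -
  define step where "step P a = {w. \<exists>v\<in>P. (v, a, w) \<in> E}" for P a
  have reach: "foldl step P w \<noteq> {} \<longleftrightarrow> (\<exists>z vs. shd vs \<in> P \<and> walk E vs (w @- z))" for P w
  proof (induction w arbitrary: P)
    case Nil
    have "\<exists>z vs. shd vs \<in> P \<and> walk E vs z" if "v \<in> P" for v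
      using walk_from_exists[OF out, of v] that by blast
    then show ?case by auto
  next
    case (Cons a w)
    have "(\<exists>vs. shd vs \<in> step P a \<and> walk E vs (w @- z)) \<longleftrightarrow>
        (\<exists>vs. shd vs \<in> P \<and> walk E vs (a ## w @- z))" for z
    proof
      assume "\<exists>vs. shd vs \<in> step P a \<and> walk E vs (w @- z)"
      then obtain vs v where "v \<in> P" "(v, a, shd vs) \<in> E" "walk E vs (w @- z)"
        by (auto simp: step_def)
      then show "\<exists>vs. shd vs \<in> P \<and> walk E vs (a ## w @- z)"
        by (intro exI[of _ "v ## vs"]) (simp add: walk_Stream)
    next
      assume "\<exists>vs. shd vs \<in> P \<and> walk E vs (a ## w @- z)"
      then show "\<exists>vs. shd vs \<in> step P a \<and> walk E vs (w @- z)"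
        by (auto simp: walk_Stream step_def)
    qed
    then show ?case using Cons.IH[of "step P a"] by simp
  qed
  have lang: "w \<in> language {s. infinite_walk_label E s} \<longleftrightarrow> foldl step UNIV w \<noteq> {}" for w
  proof
    assume "w \<in> language {s. infinite_walk_label E s}"
    then obtain u z vs where "walk E vs (u @- w @- z)"
      by (auto simp: language_def infinite_walk_label_iff)
    from walk_suffix[OF this] show "foldl step UNIV w \<noteq> {}" unfolding reach by auto
  next
    assume "foldl step UNIV w \<noteq> {}"
    then obtain z vs where "walk E vs ([] @- w @- z)" unfolding reach by auto
    then show "w \<in> language {s. infinite_walk_label E s}"
      unfolding language_def infinite_walk_label_iff by blast
  qed
  have letters: "w \<in> lists \<Sigma>" if "foldl step P w \<noteq> {}" for P w
    using that
  proof (induction w arbitrary: P)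
    case (Cons a w)
    have "w \<in> lists \<Sigma>" using Cons by auto
    moreover have "foldl step {} w = {}" for w by (induction w) (auto simp: step_def)
    with Cons.prems have "step P a \<noteq> {}" by auto
    then have "a \<in> \<Sigma>" using labels by (auto simp: step_def)
    ultimately show ?case by simp
  qed simp
  have "finite (UNIV :: 'v set set)" using fin by (simp flip: Pow_UNIV)
  then obtain enc :: "'v set \<Rightarrow> nat" where enc: "inj enc"
    using finite_imp_inj_to_nat_seg by metis
  define \<delta> where "\<delta> q a = enc (step (inv enc q) a)" for q a
  have run: "foldl \<delta> (enc P) w = enc (foldl step P w)" for P w
    by (induction w arbitrary: P) (simp_all add: \<delta>_def inv_f_f[OF enc])
  show ?thesis
    unfolding regular_language_def
  proof (intro exI conjI ballI)
    show "finite (range enc)" using \<open>finite (UNIV :: 'v set set)\<close> by simp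
    show "enc UNIV \<in> range enc" by simp
    show "enc ` (- {{}}) \<subseteq> range enc" by auto
    show "\<delta> q a \<in> range enc" for q a by (simp add: \<delta>_def)
    show "language {s. infinite_walk_label E s} = {w \<in> lists \<Sigma>. foldl \<delta> (enc UNIV) w \<in> enc ` (- {{}})}"
      using lang letters by (auto simp: run inj_image_mem_iff[OF enc])
  qed
qed

section \<open>The graph recognizes the expansions of elements of the subshift\<close>

lemma suff_nonempty: "suff a \<noteq> []"
  by (simp add: suff_def)

text \<open>Every block after the first one carries a power of \<open>\<mu>\<close>, and one \<open>\<mu>\<close> can be factored out.\<close>
lemma pi_mu_Stream: "pi_mu (a ## s) = suff a @- mu_inf (pi_mu s)"
proof -
  let ?ws = "smap (\<lambda>n. (mu ^^ n) (suff (s !! n))) nats"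
  have ne: "(mu ^^ n) (suff b) \<noteq> []" for n b
    using length_mu_funpow[of n "suff b"] suff_nonempty[of b] by auto
  have "smap (\<lambda>n. (mu ^^ n) (suff ((a ## s) !! n))) nats = suff a ## smap mu ?ws"
    by (subst smap_nats_Stream) (simp add: stream.map_comp comp_def)
  then have "pi_mu (a ## s) = suff a @- flat (smap mu ?ws)"
    using suff_nonempty[of a] by (simp add: pi_mu_def)
  also have "flat (smap mu ?ws) = mu_inf (flat ?ws)"
    using morphism_inf_flat[of mu_letter ?ws] ne by (simp add: mu_def)
  finally show ?thesis by (simp add: pi_mu_def)
qed

lemma pi_mu_binary: "pi_mu s \<in> streams {0, 1}"
proof -
  have "set ((mu ^^ n) (suff a)) \<subseteq> {0, 1}" for n a
    by (induction n) (auto simp: mu_def morphism_def mu_letter_def suff_def)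
  moreover have "(mu ^^ n) (suff b) \<noteq> []" for n b
    using length_mu_funpow[of n "suff b"] suff_nonempty[of b] by auto
  ultimately show ?thesis
    unfolding pi_mu_def streams_iff_sset by (subst sset_flat) (auto simp: stream.set_map)
qed

text \<open>
  The meaning of the vertices: \<open>s\<close> can be read from a vertex exactly if \<open>\<pi>(s)\<close> can be preceded in
  the subshift by these two letters (\<open>left_context_pi_mu_iff_walk\<close>).
\<close>
primrec left_context :: "vertex \<Rightarrow> nat list" where
  "left_context q3 = [0, 1]"
| "left_context q4 = [1, 1]"
| "left_context q5 = [0, 0]"
| "left_context q6 = [1, 0]"

lemma ex_vertex: "(\<exists>v. P v) \<longleftrightarrow> P q3 \<or> P q4 \<or> P q5 \<or> P q6"
  by (metis vertex.exhaust)

text \<open>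
  The graph is read off from the cutting lemmas.  For \<open>q3\<close> and the letter \<open>0\<close>, for instance,
  \<open>01 0 \<mu>(y)\<close> has to be cut as \<open>0|10|\<mu>(y)\<close>, so it is in the subshift exactly if \<open>11 y\<close> is, which
  gives the edge to \<open>q4\<close>; for the letter \<open>1\<close> the block would be \<open>11\<close>, so there is no edge.
\<close>
lemma left_context_step:
  assumes "a \<in> {0, 1, 2, 3}" "y \<in> streams {0, 1}"
  shows "left_context v @- suff a @- mu_inf y \<in> X_mu \<longleftrightarrow>
    (\<exists>w. (v, a, w) \<in> edges \<and> left_context w @- y \<in> X_mu)"
  using assms
  by (cases v) (auto simp: ex_vertex suff_def edges_def block_mu_inf_in_X_mu_iff
      letter_block_mu_inf_in_X_mu_iff two_blocks_mu_inf_in_X_mu_iff)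

text \<open>All four two-letter words occur in \<open>0110100\<dots>\<close>, at positions 0, 1, 5 and 2.\<close>
lemma left_context_exists: "\<exists>x. left_context v @- x \<in> X_mu"
proof -
  have t: "thue_morse !! Suc 0 = 1" "thue_morse !! 2 = 1" "thue_morse !! 3 = 0"
    "thue_morse !! 5 = 0" "thue_morse !! 6 = 0"
    using thue_morse_snth(1) thue_morse_snth(3)[of 0] thue_morse_snth(2,3)[of 1]
      thue_morse_snth(3)[of 2] thue_morse_snth(2)[of 3]
    by (simp_all add: eval_nat_numeral del: snth.simps)
  have occ: "\<exists>x. [thue_morse !! k, thue_morse !! Suc k] @- x \<in> X_mu" for k
    using sdrop_thue_morse_in_X_mu[of k] sdrop_unfold[of k thue_morse]
      sdrop_unfold[of "Suc k" thue_morse] by auto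
  show ?thesis
    using occ[of 0] occ[of 1] occ[of 2] occ[of 5] t thue_morse_snth(1)
    by (cases v) (simp_all add: eval_nat_numeral del: snth.simps)
qed

lemma left_context_pi_mu_iff_walk:
  assumes s: "s \<in> streams {0, 1, 2, 3}"
  shows "left_context v @- pi_mu s \<in> X_mu \<longleftrightarrow> (\<exists>vs. shd vs = v \<and> walk edges vs s)"
proof
  assume X: "left_context v @- pi_mu s \<in> X_mu"
  have "\<exists>f. \<forall>n. (left_context (f n) @- pi_mu (sdrop n s) \<in> X_mu \<and> (n = 0 \<longrightarrow> f n = v)) \<and>
      (f n, s !! n, f (Suc n)) \<in> edges"
  proof (rule dependent_nat_choice)
    show "\<exists>w. left_context w @- pi_mu (sdrop 0 s) \<in> X_mu \<and> (0 = (0::nat) \<longrightarrow> w = v)"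
      using X by auto
    fix w n
    assume "left_context w @- pi_mu (sdrop n s) \<in> X_mu \<and> (n = 0 \<longrightarrow> w = v)"
    then show "\<exists>w'. (left_context w' @- pi_mu (sdrop (Suc n) s) \<in> X_mu \<and>
        (Suc n = 0 \<longrightarrow> w' = v)) \<and> (w, s !! n, w') \<in> edges"
      using left_context_step[OF snth_in[OF s, of n] pi_mu_binary[of "sdrop (Suc n) s"], of w]
      unfolding sdrop_unfold[of n] pi_mu_Stream by blast
  qed
  then obtain f where "f 0 = v" "\<forall>n. (f n, s !! n, f (Suc n)) \<in> edges" by blast
  then show "\<exists>vs. shd vs = v \<and> walk edges vs s"
    by (intro exI[of _ "smap f nats"]) (simp add: walk_def)
next
  assume "\<exists>vs. shd vs = v \<and> walk edges vs s"
  then obtain vs where vs: "shd vs = v" "walk edges vs s" by blast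
  \<comment> \<open>take an element of the subshift that begins with the context of the \<open>n\<close>-th vertex; going
    back along the first \<open>n\<close> edges gives one that begins with the context of \<open>v\<close> followed by a
    prefix of \<open>\<pi>(s)\<close> of length at least \<open>n\<close>\<close>
  have "\<exists>u y r. n \<le> length u \<and> pi_mu s = u @- r \<and> left_context v @- u @- y \<in> X_mu" for n
    using s vs
  proof (induction n arbitrary: s v vs)
    case 0
    obtain x where "left_context v @- x \<in> X_mu" using left_context_exists by blast
    then show ?case by (intro exI[of _ "[]"] exI) auto
  next
    case (Suc n)
    obtain a s' where s: "s = a ## s'" by (cases s)
    define w where "w = shd (stl vs)"
    have a: "a \<in> {0, 1, 2, 3}" "s' \<in> streams {0, 1, 2, 3}" and e: "(v, a, w) \<in> edges"
      and w: "walk edges (stl vs) s'"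
      using Suc.prems by (auto simp: s streams_Stream walk_Stream w_def)
    obtain u y r where u: "n \<le> length u" "pi_mu s' = u @- r" "left_context w @- u @- y \<in> X_mu"
      using Suc.IH[OF a(2) w_def[symmetric] w] by blast
    have "u @- y \<in> streams {0, 1}"
      using X_mu_binary[OF u(3)] by (simp add: streams_iff_sset)
    then have "left_context v @- suff a @- mu_inf (u @- y) \<in> X_mu"
      using left_context_step[OF a(1)] e u(3) by blast
    then have "left_context v @- (suff a @ mu u) @- mu_inf y \<in> X_mu" by (simp add: mu_inf_shift)
    moreover have "pi_mu s = (suff a @ mu u) @- mu_inf r" by (simp add: s pi_mu_Stream u(2) mu_inf_shift)
    moreover have "Suc n \<le> length (suff a @ mu u)"
      using u(1) suff_nonempty[of a] by (cases "suff a") (simp_all add: length_mu)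
    ultimately show ?case by blast
  qed
  then have "\<exists>u x' y'. n \<le> length u \<and> left_context v @- pi_mu s = u @- x' \<and> u @- y' \<in> X_mu" for n
    by (metis shift_append length_append trans_le_add2)
  then show "left_context v @- pi_mu s \<in> X_mu" by (rule X_mu_closed)
qed

lemma S_mu_iff_walk_label:
  assumes "s \<in> streams {0, 1, 2, 3}"
  shows "s \<in> S_mu \<longleftrightarrow> infinite_walk_label edges s"
proof -
  have "pi_mu s \<in> X_mu \<longleftrightarrow> (\<exists>v. left_context v @- pi_mu s \<in> X_mu)"
  proof
    assume "pi_mu s \<in> X_mu"
    then obtain a b where "a \<in> {0, 1}" "b \<in> {0, 1}" "a ## b ## pi_mu s \<in> X_mu"
      using X_mu_extend_left by meson
    then show "\<exists>v. left_context v @- pi_mu s \<in> X_mu" by (auto simp: ex_vertex)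
  next
    assume "\<exists>v. left_context v @- pi_mu s \<in> X_mu"
    then show "pi_mu s \<in> X_mu" by (auto simp: ex_vertex intro: X_mu_tail)
  qed
  then show ?thesis
    using assms left_context_pi_mu_iff_walk[OF assms] by (auto simp: S_mu_def infinite_walk_label_iff)
qed

section \<open>The map on expansions\<close>

lemma suff_inv_simps [simp]:
  "suff_inv [0] = 0" "suff_inv [1] = 1" "suff_inv [0, 1] = 2" "suff_inv [1, 0] = 3"
proof -
  have "suff_inv (suff a) = a" if "a \<in> {0, 1, 2, 3}" for a
    unfolding suff_inv_def using bij_betw_suff that by (simp add: bij_betw_def)
  from this[of 0] this[of 1] this[of 2] this[of 3]
  show "suff_inv [0] = 0" "suff_inv [1] = 1" "suff_inv [0, 1] = 2" "suff_inv [1, 0] = 3"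
    by (simp_all add: suff_def)
qed

lemma mu_simps: "mu [] = []" "mu (0 # w) = 0 # 1 # mu w" "mu (1 # w) = 1 # 0 # mu w"
  by (simp_all add: mu_def mu_letter_def)

lemma suff_inv_mu_suff: "a \<in> {0, 1} \<Longrightarrow> suff_inv (mu (suff a)) = a + 2"
  using mu_simps suff_inv_simps by (auto simp: suff_def simp del: suff_inv_simps)

lemma long_suff_iff: "2 \<le> length (suff a) \<longleftrightarrow> a \<notin> {0, 1}"
  by (auto simp: suff_def)

text \<open>
  Adding two turns a letter \<open>a\<close> into the code of \<open>\<mu>(a)\<close>.  If \<open>c(b)\<close> has the
  letters \<open>d\<close> and \<open>e\<close>, then \<open>\<mu>(d) = d e\<close> has the code \<open>b\<close> again, and \<open>e\<close> has the code \<open>3 - b\<close>.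
\<close>
lemma G_mu_first_long_letter:
  assumes x: "x \<in> lists {0, 1}" and b: "b \<in> {2, 3}"
  shows "G_mu (x @- b ## z) = map (\<lambda>a. a + 2) x @- b ## (3 - b) ## z"
proof -
  let ?s = "x @- b ## z"
  have small: "?s !! i \<in> {0, 1}" if "i < length x" for i
    using that x by (auto simp: in_lists_conv_set)
  have long: "2 \<le> length (suff (?s !! length x))"
    using b by (auto simp: suff_def)
  have least: "(LEAST r. 2 \<le> length (suff (?s !! r))) = length x"
  proof (rule Least_equality[of _ "length x"])
    show "length x \<le> r" if "2 \<le> length (suff (?s !! r))" for r
      using that small[of r] unfolding long_suff_iff by force
  qed (rule long)
  show ?thesis
  proof (rule stream_eqI)
    fix i
    have G: "G_mu ?s !! i =
      (if i < length x then suff_inv (mu (suff (?s !! i)))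
       else if i = length x then suff_inv (mu [hd (suff b)])
       else if i = length x + 1 then suff_inv (tl (suff b))
       else ?s !! (i - 1))"
    proof -
      have "\<exists>r. 2 \<le> length (suff (?s !! r))" using long by blast
      then show ?thesis unfolding G_mu_def Let_def least by simp
    qed
    have "i < length x \<or> i = length x \<or> i = length x + 1 \<or> (\<exists>k. i = length x + 2 + k)"
      by presburger
    then consider "i < length x" | "i = length x" | "i = length x + 1"
      | k where "i = length x + 2 + k"
      by blast
    moreover have beyond: "(map f x @- w) !! (length x + j) = w !! j" for f :: "nat \<Rightarrow> nat" and w j
      by simp
    ultimately show "G_mu ?s !! i = (map (\<lambda>a. a + 2) x @- b ## (3 - b) ## z) !! i"
    proof cases
      case 1
      then show ?thesis using suff_inv_mu_suff[OF small[OF 1]] by (simp add: G)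
    next
      case 2
      then show ?thesis
        using b beyond[of "\<lambda>a. a + 2" _ 0] suff_inv_simps mu_simps unfolding G by (auto simp: suff_def)
    next
      case 3
      then show ?thesis
        using b beyond[of "\<lambda>a. a + 2" _ 1] suff_inv_simps unfolding G by (auto simp: suff_def)
    next
      case 4
      then show ?thesis
        using beyond[of "\<lambda>a. a + 2" _ "2 + k"] beyond[of "\<lambda>a. a" _ "1 + k"] unfolding G by simp
    qed
  qed
qed

lemma G_mu_binary:
  assumes "s \<in> streams {0, 1}"
  shows "G_mu s = smap (\<lambda>a. a + 2) s"
proof (rule stream_eqI)
  fix n
  have "\<not> (\<exists>r. 2 \<le> length (suff (s !! r)))"
    using snth_in[OF assms] unfolding long_suff_iff by blast
  then show "G_mu s !! n = smap (\<lambda>a. a + 2) s !! n"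
    using suff_inv_mu_suff[OF snth_in[OF assms]] by (simp add: G_mu_def)
qed

lemma morphism_lambda_binary: "x \<in> lists {0, 1} \<Longrightarrow> morphism lambda_letter x = map (\<lambda>a. a + 2) x"
  by (induction x) (auto simp: lambda_letter_def)

lemma lambda_long_letter: "b \<in> {2, 3} \<Longrightarrow> lambda_letter b = [b, 3 - b]"
  by (auto simp: lambda_letter_def)

lemma H_mu_long_letter: "b \<in> {2, 3} \<Longrightarrow> H_mu (b ## z) = (3 - b) ## z"
  using G_mu_first_long_letter[of "[]" b z] by (simp add: H_mu_def)

lemma H_mu_letter_binary:
  assumes "a \<in> {0, 1}" "z \<in> streams {0, 1}"
  shows "H_mu (a ## z) = morphism_inf lambda_letter z"
proof -
  have "smap lambda_letter z = smap (\<lambda>a. [a + 2]) z"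
  proof (rule stream_eqI)
    fix n
    show "smap lambda_letter z !! n = smap (\<lambda>a. [a + 2]) z !! n"
      using binary_snth[OF assms(2), of n] by (auto simp: lambda_letter_def)
  qed
  moreover have "flat (smap (\<lambda>a. [a + 2]) z) = smap (\<lambda>a. a + 2) z"
    by (coinduction arbitrary: z) auto
  ultimately show ?thesis
    using G_mu_binary[of "a ## z"] assms by (simp add: H_mu_def morphism_inf_def streams_Stream)
qed

lemma H_mu_first_long_letter:
  assumes "a \<in> {0, 1}" "x \<in> lists {0, 1}" "b \<in> {2, 3}"
  shows "H_mu (a ## (x @ [b]) @- z) = morphism lambda_letter (x @ [b]) @- z"
  using G_mu_first_long_letter[of "a # x" b z] assms
  by (simp add: H_mu_def morphism_lambda_binary lambda_long_letter)

lemma stream_first_long_letter: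
  assumes "s \<in> streams {0, 1, 2, 3 :: nat}"
  shows "s \<in> streams {0, 1} \<or> (\<exists>x\<in>lists {0, 1}. \<exists>b\<in>{2, 3}. \<exists>z. s = (x @ [b]) @- z)"
proof (cases "s \<in> streams {0, 1}")
  case False
  define n where "n = (LEAST n. s !! n \<notin> {0, 1})"
  obtain m where "s !! m \<notin> {0, 1}" using False unfolding streams_iff_snth by blast
  then have "s !! n \<notin> {0, 1}"
    unfolding n_def by (rule LeastI[of "\<lambda>n. s !! n \<notin> {0, 1}"])
  then have "s !! n \<in> {2, 3}" using snth_in[OF assms, of n] by auto
  moreover have "s !! i \<in> {0, 1}" if "i < n" for i
    using not_less_Least[of i "\<lambda>n. s !! n \<notin> {0, 1}"] that unfolding n_def by simp
  then have "\<forall>a\<in>set (stake n s). a \<in> {0, 1}" by (metis in_set_conv_nth length_stake stake_nth)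
  then have "stake n s \<in> lists {0, 1}" by (simp only: in_lists_conv_set)
  moreover have "s = (stake n s @ [s !! n]) @- sdrop (Suc n) s"
    using stake_sdrop[of "Suc n" s, symmetric] unfolding stake_Suc .
  ultimately show ?thesis by blast
qed simp

text \<open>
  The morphism \<open>\<lambda>\<close> represents \<open>\<mu>\<close> on expansions.  A letter \<open>a\<close> becomes the code of \<open>\<mu>(a)\<close> in the same
  position; a long letter becomes two letters, so that all later letters move one position to the
  right and acquire one more power of \<open>\<mu>\<close>.
\<close>
lemma pi_mu_lambda:
  assumes "x \<in> lists {0, 1}" "b \<in> {2, 3}"
  shows "pi_mu (morphism lambda_letter (x @ [b]) @- z) = mu_inf (pi_mu ((x @ [b]) @- z))"
  using assms
proof (induction x)
  case Nil
  then show ?case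
    by (auto simp: lambda_letter_def pi_mu_Stream mu_inf_shift suff_def mu_simps
        mu_inf_Stream simp del: One_nat_def)
next
  case (Cons a x)
  then have "a = 0 \<or> a = 1" by auto
  then have "lambda_letter a = [a + 2]" "suff (a + 2) = mu (suff a)"
    by (auto simp: lambda_letter_def suff_def mu_def mu_letter_def)
  then show ?case using Cons by (simp add: pi_mu_Stream mu_inf_shift)
qed

lemma pi_mu_lambda_binary:
  assumes z: "z \<in> streams {0, 1}"
  shows "pi_mu (morphism_inf lambda_letter z) = mu_inf (pi_mu z)"
proof (rule stream_eq_by_prefixes)
  fix n
  have "\<exists>u x' y'. n \<le> length u \<and> pi_mu (morphism_inf lambda_letter z) = u @- x' \<and>
      mu_inf (pi_mu z) = u @- y'"
    using z
  proof (induction n arbitrary: z)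
    case 0
    then show ?case by (intro exI[of _ "[]"]) auto
  next
    case (Suc n)
    obtain a w where zw: "z = a ## w" by (cases z)
    then have w: "w \<in> streams {0, 1}" and a: "a = 0 \<or> a = 1"
      using Suc.prems by (auto simp: streams_Stream)
    obtain u x' y' where u: "n \<le> length u"
      "pi_mu (morphism_inf lambda_letter w) = u @- x'" "mu_inf (pi_mu w) = u @- y'"
      using Suc.IH[OF w] by blast
    have "lambda_letter a = [a + 2]" "suff (a + 2) = mu (suff a)"
      using a by (auto simp: lambda_letter_def suff_def mu_def mu_letter_def)
    then have "pi_mu (morphism_inf lambda_letter z) = (mu (suff a) @ mu u) @- mu_inf x'"
      "mu_inf (pi_mu z) = (mu (suff a) @ mu u) @- mu_inf y'"
      using u by (simp_all add: zw morphism_inf_Stream pi_mu_Stream mu_inf_shift)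
    moreover have "Suc n \<le> length (mu (suff a) @ mu u)"
      using u(1) a by (auto simp: length_mu suff_def)
    ultimately show ?case by blast
  qed
  then show "\<exists>u x' y'. n \<le> length u \<and> pi_mu (morphism_inf lambda_letter z) = u @- x' \<and>
      mu_inf (pi_mu z) = u @- y'" .
qed

text \<open>
  If \<open>s\<close> starts with \<open>0\<close> or \<open>1\<close>, the shift deletes it and leaves \<open>\<mu>(\<pi>(T(s)))\<close>; otherwise the
  shift turns the initial block \<open>01\<close> or \<open>10\<close> into its last letter.
\<close>
lemma pi_mu_H_mu:
  assumes "s \<in> streams {0, 1, 2, 3}"
  shows "pi_mu (H_mu s) = stl (pi_mu s)"
proof -
  obtain a z where s: "s = a ## z" by (cases s)
  then have a: "a \<in> {0, 1, 2, 3}" and z: "z \<in> streams {0, 1, 2, 3}"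
    using assms by (auto simp: streams_Stream)
  show ?thesis
  proof (cases "a \<in> {0, 1}")
    case True
    then have "stl (pi_mu s) = mu_inf (pi_mu z)" by (auto simp: s pi_mu_Stream suff_def)
    then show ?thesis
      using stream_first_long_letter[OF z] H_mu_letter_binary[OF True] pi_mu_lambda_binary
        H_mu_first_long_letter[OF True] pi_mu_lambda unfolding s by metis
  next
    case False
    then have "a \<in> {2, 3}" using a by auto
    then show ?thesis using H_mu_long_letter[of a z] by (auto simp: s pi_mu_Stream suff_def)
  qed
qed

lemma H_mu_streams:
  assumes "s \<in> streams {0, 1, 2, 3}"
  shows "H_mu s \<in> streams {0, 1, 2, 3}"
proof -
  obtain a z where s: "s = a ## z" by (cases s)
  then have a: "a \<in> {0, 1, 2, 3}" and z: "z \<in> streams {0, 1, 2, 3}"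
    using assms by (auto simp: streams_Stream)
  consider "a \<in> {2, 3}" | "a \<in> {0, 1}" "z \<in> streams {0, 1}"
    | x b y where "a \<in> {0, 1}" "x \<in> lists {0, 1}" "b \<in> {2, 3}" "z = (x @ [b]) @- y"
    using a stream_first_long_letter[OF z] by blast
  then show ?thesis
  proof cases
    case 1
    then show ?thesis using z H_mu_long_letter[of a z] by (auto simp: s streams_Stream)
  next
    case 2
    then have "H_mu s = stl (smap (\<lambda>a. a + 2) s)"
      using G_mu_binary[of s] by (simp add: s H_mu_def streams_Stream)
    then show ?thesis
      using 2 by (auto simp: s intro!: smap_streams[of z "{0, 1}"])
  next
    case 3
    then have "y \<in> streams {0, 1, 2, 3}" using z by (simp add: streams_iff_sset)
    moreover have "set (morphism lambda_letter (x @ [b])) \<subseteq> {0, 1, 2, 3}"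
      by (auto simp: morphism_def lambda_letter_def split: if_splits)
    ultimately show ?thesis
      using H_mu_first_long_letter[OF 3(1-3)] 3(4) by (simp add: s streams_iff_sset)
  qed
qed

lemma edges_labels: "(v, a, w) \<in> edges \<Longrightarrow> a \<in> {0, 1, 2, 3}"
  by (auto simp: edges_def)

lemma S_mu_eq: "S_mu = {s. infinite_walk_label edges s}"
proof -
  have "s \<in> streams {0, 1, 2, 3}" if walk: "infinite_walk_label edges s" for s
  proof -
    obtain vs where "walk edges vs s" using walk unfolding infinite_walk_label_iff by blast
    then have "s !! n \<in> {0, 1, 2, 3}" for n unfolding walk_def by (meson edges_labels)
    then show ?thesis unfolding streams_iff_snth by blast
  qed
  moreover have "S_mu \<subseteq> streams {0, 1, 2, 3}" by (auto simp: S_mu_def)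
  ultimately show ?thesis using S_mu_iff_walk_label by blast
qed

lemma S_mu_regular: "regular_language {0, 1, 2, 3} (language S_mu)"
  unfolding S_mu_eq
proof (rule regular_language_of_walk_labels)
  have "(UNIV :: vertex set) = {q3, q4, q5, q6}" by (auto intro: vertex.exhaust)
  then show "finite (UNIV :: vertex set)" by (metis finite.emptyI finite_insert)
  show "\<exists>a w. (v, a, w) \<in> edges" for v by (cases v) (auto simp: edges_def)
qed (rule edges_labels)

theorem theorem5:
  shows "regular_language {0, 1, 2, 3} (language S_mu)
    \<and> (\<forall>s\<in>streams {0, 1, 2, 3}. s \<in> S_mu \<longleftrightarrow> infinite_walk_label edges s)
    \<and> (\<forall>s\<in>S_mu. H_mu s \<in> S_mu)
    \<and> (\<forall>s\<in>S_mu.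
         (\<forall>z. s = 2 ## z \<longrightarrow> H_mu s = 1 ## z)
       \<and> (\<forall>z. s = 3 ## z \<longrightarrow> H_mu s = 0 ## z)
       \<and> (\<forall>a\<in>{0, 1}. \<forall>z\<in>streams {0, 1}.
            s = a ## z \<longrightarrow> H_mu s = morphism_inf lambda_letter z)
       \<and> (\<forall>a\<in>{0, 1}. \<forall>x\<in>lists {0, 1}. \<forall>z.
            s = a ## (x @ [2]) @- z \<longrightarrow> H_mu s = morphism lambda_letter (x @ [2]) @- z)
       \<and> (\<forall>a\<in>{0, 1}. \<forall>x\<in>lists {0, 1}. \<forall>z.
            s = a ## (x @ [3]) @- z \<longrightarrow> H_mu s = morphism lambda_letter (x @ [3]) @- z))"
proof (intro conjI ballI allI impI)
  show "regular_language {0, 1, 2, 3} (language S_mu)" by (rule S_mu_regular)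
  show "s \<in> S_mu \<longleftrightarrow> infinite_walk_label edges s" if "s \<in> streams {0, 1, 2, 3}" for s
    using that by (rule S_mu_iff_walk_label)
  show "H_mu s \<in> S_mu" if "s \<in> S_mu" for s
    using that H_mu_streams pi_mu_H_mu X_mu_stl by (simp add: S_mu_def)
  show "H_mu s = 1 ## z" if "s = 2 ## z" for s z
    using H_mu_long_letter[of 2 z] that by simp
  show "H_mu s = 0 ## z" if "s = 3 ## z" for s z
    using H_mu_long_letter[of 3 z] that by simp
  show "H_mu s = morphism_inf lambda_letter z"
    if "a \<in> {0, 1}" "z \<in> streams {0, 1}" "s = a ## z" for s a z
    using H_mu_letter_binary that by simp
  show "H_mu s = morphism lambda_letter (x @ [2]) @- z"
    if "a \<in> {0, 1}" "x \<in> lists {0, 1}" "s = a ## (x @ [2]) @- z" for s a x z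
    using H_mu_first_long_letter[of a x 2 z] that by simp
  show "H_mu s = morphism lambda_letter (x @ [3]) @- z"
    if "a \<in> {0, 1}" "x \<in> lists {0, 1}" "s = a ## (x @ [3]) @- z" for s a x z
    using H_mu_first_long_letter[of a x 3 z] that by simp
qed

end
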